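(* Let $X$ and $Y$ be connected graphs, each on $n\geq 3$ vertices. Suppose $x_0\in V(X)$ and $y_0\in V(Y)$ are cut vertices such that the connected components of $X\vert_{V(X)\setminus\{x_0\}}$ are $X_1,\ldots,X_r$ and the connected components of $Y\vert_{V(Y)\setminus\{y_0\}}$ are $Y_1,\ldots,Y_s$. Let $\mathcal M$ denote the set of $r\times s$ matrices with nonnegative integer entries in which the $i$-th row sums to $|V(X_i)|$ (for each $1\le i\le r$) and the $j$-th column sums to $|V(Y_j)|$ (for each $1\le j\le s$). Then the number of connected components of $\mathsf{FS}(X,Y)$ is at least $|\mathcal M|$.
   Context: All graphs are finite and simple. For graphs $X,Y$ with $|V(X)|=|V(Y)|$, the friends-and-strangers graph $\mathsf{FS}(X,Y)$ has as vertices all bijections $\sigma\colon V(X)\to V(Y)$; two bijections $\sigma,\sigma'$ are adjacent iff there is an edge $\{a,b\}\in E(X)$ with $\{\sigma(a),\sigma(b)\}\in E(Y)$, $\sigma(a)=\sigma'(b)$, $\sigma(b)=\sigma'(a)$, and $\sigma(c)=\sigma'(c)$ for all $c\in V(X)\setminus\{a,b\}$. $G\vert_{V_0}$ is the induced subgraph of $G$ on the vertex set $V_0$. A cut vertex of $G$ is a vertex $v$ such that $G\vert_{V(G)\setminus\{v\}}$ has more connected components than $G$. *)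

theory Defs
  imports "Graph_Theory.Graph_Theory" "Jordan_Normal_Form.Matrix"
begin

text \<open>
  A finite simple graph is a \<^locale>\<open>pair_graph\<close>, an edge \<open>{a, b}\<close> being represented by the two arcs
  \<open>(a, b)\<close> and \<open>(b, a)\<close>. In such a symmetric digraph strong connectivity is connectivity
  (lemma \<open>strongly_connected_iff_connected\<close>), so the strongly connected components are the
  connected components.
\<close>

abbreviation components :: "('a, 'b) pre_digraph \<Rightarrow> ('a, 'b) pre_digraph set" where
  "components G \<equiv> pre_digraph.sccs G"

abbreviation delete_vertex :: "'a pair_pre_digraph \<Rightarrow> 'a \<Rightarrow> ('a, 'a \<times> 'a) pre_digraph" where
  "delete_vertex G v \<equiv> with_proj G \<restriction> (pverts G - {v})"

definition cut_vertex :: "'a pair_pre_digraph \<Rightarrow> 'a \<Rightarrow> bool" where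
  "cut_vertex G v \<longleftrightarrow>
     v \<in> pverts G \<and> card (components (with_proj G)) < card (components (delete_vertex G v))"

text \<open>
  Extensionality makes a bijection between the vertex sets a unique HOL function.
\<close>

definition bijections :: "'a set \<Rightarrow> 'b set \<Rightarrow> ('a \<Rightarrow> 'b) set" where
  "bijections A B = {\<sigma> \<in> extensional A. bij_betw \<sigma> A B}"

definition FS :: "'a pair_pre_digraph \<Rightarrow> 'b pair_pre_digraph \<Rightarrow> ('a \<Rightarrow> 'b) pair_pre_digraph" where
  "FS X Y =
     \<lparr> pverts = bijections (pverts X) (pverts Y),
       parcs = {(\<sigma>, \<sigma>'). \<sigma> \<in> bijections (pverts X) (pverts Y) \<and> \<sigma>' \<in> bijections (pverts X) (pverts Y) \<and>
         (\<exists>a b. (a, b) \<in> parcs X \<and> (\<sigma> a, \<sigma> b) \<in> parcs Y \<and> \<sigma> a = \<sigma>' b \<and> \<sigma> b = \<sigma>' a \<and>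
            (\<forall>c \<in> pverts X - {a, b}. \<sigma> c = \<sigma>' c))} \<rparr>"

definition matrices_with_sums :: "nat \<Rightarrow> nat \<Rightarrow> (nat \<Rightarrow> nat) \<Rightarrow> (nat \<Rightarrow> nat) \<Rightarrow> nat mat set" where
  "matrices_with_sums r s p q =
     {M \<in> carrier_mat r s. (\<forall>i<r. (\<Sum>j<s. M $$ (i, j)) = p i) \<and> (\<forall>j<s. (\<Sum>i<r. M $$ (i, j)) = q j)}"

lemma strongly_connected_iff_connected:
  assumes "sym_digraph G"
  shows "strongly_connected G \<longleftrightarrow> Digraph_Component.connected G"
proof -
  interpret sym_digraph G by fact
  have "arcs_ends (with_proj (mk_symmetric G)) = arcs_ends G"
    using graph_symmetric by (auto simp: mk_symmetric_def arcs_ends_conv)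
  then show ?thesis
    by (simp add: Digraph_Component.connected_def strongly_connected_def reachable_def
        mk_symmetric_def)
qed

lemma pair_graph_FS:
  assumes "pair_graph X" "pair_graph Y"
  shows "pair_graph (FS X Y)"
proof -
  interpret X: pair_graph X by fact
  interpret Y: pair_graph Y by fact
  let ?B = "bijections (pverts X) (pverts Y)"
  have "?B \<subseteq> (\<Pi>\<^sub>E x\<in>pverts X. pverts Y)"
    by (auto simp: bijections_def PiE_def bij_betw_def)
  then have fin: "finite ?B"
    using finite_PiE[OF X.pair_finite_verts, of "\<lambda>_. pverts Y"] Y.pair_finite_verts
      finite_subset by blast
  have sub: "parcs (FS X Y) \<subseteq> ?B \<times> ?B"
    by (auto simp: FS_def)
  have symm: "(\<tau>, \<sigma>) \<in> parcs (FS X Y)" if "(\<sigma>, \<tau>) \<in> parcs (FS X Y)" for \<sigma> \<tau>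
  proof -
    from that obtain a b where ab: "(a, b) \<in> parcs X" "(\<sigma> a, \<sigma> b) \<in> parcs Y" "\<sigma> a = \<tau> b"
      "\<sigma> b = \<tau> a" "\<forall>c \<in> pverts X - {a, b}. \<sigma> c = \<tau> c" "\<sigma> \<in> ?B" "\<tau> \<in> ?B"
      by (auto simp: FS_def)
    have "(\<tau> a, \<tau> b) \<in> parcs Y"
      using Y.graph_symmetric[of "\<sigma> a" "\<sigma> b"] ab by simp
    with ab have "\<exists>a b. (a, b) \<in> parcs X \<and> (\<tau> a, \<tau> b) \<in> parcs Y \<and> \<tau> a = \<sigma> b \<and> \<tau> b = \<sigma> a \<and>
        (\<forall>c \<in> pverts X - {a, b}. \<tau> c = \<sigma> c)"
      by metis
    with ab(6,7) show ?thesis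
      by (simp add: FS_def)
  qed
  have loop: "\<sigma> \<noteq> \<tau>" if st: "(\<sigma>, \<tau>) \<in> parcs (FS X Y)" for \<sigma> \<tau>
  proof
    assume eq: "\<sigma> = \<tau>"
    from st obtain a b where "(\<sigma> a, \<sigma> b) \<in> parcs Y" "\<sigma> a = \<tau> b"
      unfolding FS_def by fastforce
    with eq have "(\<sigma> a, \<sigma> b) \<in> parcs Y" "\<sigma> a = \<sigma> b"
      by simp_all
    then show False using Y.no_loops' by metis
  qed
  have verts: "pverts (FS X Y) = ?B"
    by (simp add: FS_def)
  show ?thesis
  proof unfold_locales
    show "fst e \<in> pverts (FS X Y)" and "snd e \<in> pverts (FS X Y)" if "e \<in> parcs (FS X Y)" for e
      using that sub verts by auto
    show "finite (pverts (FS X Y))"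
      using fin verts by simp
    show "finite (parcs (FS X Y))"
      using sub fin by (meson finite_SigmaI finite_subset)
    show "fst e \<noteq> snd e" if "e \<in> parcs (FS X Y)" for e
      using that loop by (cases e) auto
    show "symmetric (with_proj (FS X Y))"
      using symm by (auto simp: symmetric_def intro: symI)
  qed
qed

end

theory Submission
  imports Defs "HOL-Combinatorics.Transposition"
begin

text \<open>
  If \<open>\<sigma>\<close> sends \<open>x\<^sub>0\<close> to \<open>y\<^sub>0\<close>, it restricts to a bijection
  between the other vertices, and one can count how many vertices of \<open>X\<^sub>i\<close> it sends into
  \<open>Y\<^sub>j\<close>. A general \<open>\<sigma>\<close> is brought to this form by composing it with the
  transposition of \<open>y\<^sub>0\<close> and \<open>\<sigma> x\<^sub>0\<close>: away from \<open>x\<^sub>0\<close> this replaces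
  the value \<open>y\<^sub>0\<close> by \<open>\<sigma> x\<^sub>0\<close> (\<open>bypass\<close>). The matrix of counts of the bypassed
  bijection does not change along an edge of \<open>FS X Y\<close>. Indeed, a swap along an edge of \<open>X\<close>
  that avoids \<open>x\<^sub>0\<close> exchanges the bypassed values of two vertices of one \<open>X\<^sub>i\<close>. A swap
  along an edge at \<open>x\<^sub>0\<close> leaves the bypassed values alone if \<open>y\<^sub>0\<close> is one of the two
  swapped values; otherwise it exchanges two bypassed values that are adjacent in \<open>Y - y\<^sub>0\<close>
  and hence lie in one \<open>Y\<^sub>j\<close> (\<open>block_count_FS_arc\<close>).

  So the matrix is an invariant of the connected components of \<open>FS X Y\<close>. Every matrix in question
  is the matrix of some \<open>\<sigma>\<close> with \<open>\<sigma> x\<^sub>0 = y\<^sub>0\<close>, because the prescribed row and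
  column sums are exactly what is needed to cut each \<open>X\<^sub>i\<close> and each \<open>Y\<^sub>j\<close> into pieces
  of the prescribed sizes and to match the pieces up (\<open>exists_bij_with_block_counts\<close>).
  Distinct matrices therefore come from distinct components.
\<close>

section \<open>Components as the fibres of a labelling\<close>

text \<open>
  A function that is constant along arcs is constant on every strongly connected component, so it
  takes at most as many values as there are components.
\<close>

lemma (in fin_digraph) card_le_card_sccs_of_invariant:
  assumes const: "\<And>u v. u \<rightarrow>\<^bsub>G\<^esub> v \<Longrightarrow> f u = f v"
    and "S \<subseteq> f ` verts G"
  shows "card S \<le> card sccs"
proof -
  have reach: "f u = f v" if "u \<rightarrow>\<^sup>*\<^bsub>G\<^esub> v" for u v
    using that by (induction rule: reachable_induct) (auto dest: const)
  define g where "g = (\<lambda>C. f (SOME u. u \<in> C))"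
  have g: "g (scc_of u) = f u" if "u \<in> verts G" for u
  proof -
    have "(SOME w. w \<in> scc_of u) \<in> scc_of u"
      using in_scc_of_self[OF that] by (rule someI)
    then show ?thesis
      unfolding g_def by (auto simp: scc_of_def dest: reach)
  qed
  have "S \<subseteq> g ` sccs_verts"
    using assms(2) g unfolding sccs_verts_conv_scc_of by force
  then have "card S \<le> card sccs_verts"
    by (rule surj_card_le[OF finite_sccs_verts])
  then show ?thesis
    by (simp add: card_sccs_verts)
qed

text \<open>
  An enumeration of the components is turned into a labelling of the vertices: the combinatorial
  part of the proof only needs that the components are its fibres and that adjacent vertices
  have equal labels.
\<close>

lemma (in sym_digraph) component_labelling:
  assumes C: "bij_betw C {..<r} sccs"
  obtains p where "\<forall>v \<in> verts G. p v < r"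
    and "\<forall>i < r. {v \<in> verts G. p v = i} = verts (C i)"
    and "\<forall>u v. u \<rightarrow>\<^bsub>G\<^esub> v \<longrightarrow> p u = p v"
proof -
  have in_sccs: "C i \<in> sccs" if "i < r" for i
    using C that by (auto simp: bij_betw_def)
  have unique: "i = j" if "i < r" "j < r" "v \<in> verts (C i)" "v \<in> verts (C j)" for i j v
    using scc_disj[of "C i" "C j"] in_sccs that bij_betw_imp_inj_on[OF C]
    by (auto dest: inj_onD)
  have "\<exists>i<r. v \<in> verts (C i)" if "v \<in> verts G" for v
    using induce_reachable_is_in_sccs[OF that] bij_betw_imp_surj_on[OF C] that
    by (metis (no_types, lifting) imageE induce_subgraph_verts lessThan_iff mem_Collect_eq
        reachable_refl)
  then obtain p where p: "p v < r" "v \<in> verts (C (p v))" if "v \<in> verts G" for v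
    by metis
  have fibre: "{v \<in> verts G. p v = i} = verts (C i)" if "i < r" for i
  proof -
    have "verts (C i) \<subseteq> verts G"
      using in_sccs_imp_induced[OF in_sccs[OF that]] by (auto dest!: induced_imp_subgraph)
    with p unique that show ?thesis
      by blast
  qed
  have adj: "p u = p v" if "u \<rightarrow>\<^bsub>G\<^esub> v" for u v
  proof -
    have uv: "u \<in> verts G" "v \<in> verts G"
      using adj_in_verts[OF that] by auto
    have "verts (C (p u)) \<in> sccs_verts"
      using in_sccs p(1) uv by (auto simp: sccs_verts_conv)
    moreover have "u \<rightarrow>\<^sup>*\<^bsub>G\<^esub> v" "v \<rightarrow>\<^sup>*\<^bsub>G\<^esub> u"
      using that graph_symmetric by auto
    ultimately have "v \<in> verts (C (p u))"
      using p(2)[OF uv(1)] unfolding in_sccs_verts_conv_reachable by blast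
    then show ?thesis
      using unique p uv by blast
  qed
  from p(1) fibre adj show ?thesis
    by (intro that[of p]) blast+
qed

lemma vertex_labelling_of_delete_vertex:
  assumes "pair_graph X" and "bij_betw Xc {..<r} (components (delete_vertex X x\<^sub>0))"
  obtains p where "\<forall>v \<in> pverts X - {x\<^sub>0}. p v < r"
    and "\<forall>i < r. {v \<in> pverts X - {x\<^sub>0}. p v = i} = verts (Xc i)"
    and "\<forall>a b. (a, b) \<in> parcs X \<longrightarrow> a \<noteq> x\<^sub>0 \<longrightarrow> b \<noteq> x\<^sub>0 \<longrightarrow> p a = p b"
proof -
  interpret X: pair_graph X by fact
  interpret D: sym_digraph "delete_vertex X x\<^sub>0"
    by (rule X.induced_graph_imp_graph[OF X.induced_induce]) auto
  obtain p where p: "\<forall>v \<in> verts (delete_vertex X x\<^sub>0). p v < r"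
      "\<forall>i < r. {v \<in> verts (delete_vertex X x\<^sub>0). p v = i} = verts (Xc i)"
      "\<forall>u v. u \<rightarrow>\<^bsub>delete_vertex X x\<^sub>0\<^esub> v \<longrightarrow> p u = p v"
    by (rule D.component_labelling[OF assms(2)])
  have "a \<rightarrow>\<^bsub>delete_vertex X x\<^sub>0\<^esub> b" if "(a, b) \<in> parcs X" "a \<noteq> x\<^sub>0" "b \<noteq> x\<^sub>0" for a b
    using that X.wellformed by (force simp: arcs_ends_conv)
  with p show ?thesis
    by (intro that[of p]) simp_all
qed


section \<open>The block counts of a bijection\<close>

definition block_count :: "'a set \<Rightarrow> ('a \<Rightarrow> nat) \<Rightarrow> ('b \<Rightarrow> nat) \<Rightarrow> ('a \<Rightarrow> 'b) \<Rightarrow> nat \<Rightarrow> nat \<Rightarrow> nat" where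
  "block_count A p q f i j = card {a \<in> A. p a = i \<and> q (f a) = j}"

lemma block_count_cong:
  assumes "\<And>a. a \<in> A \<Longrightarrow> q (f a) = q (g a)"
  shows "block_count A p q f = block_count A p q g"
proof -
  have "{a \<in> A. p a = i \<and> q (f a) = j} = {a \<in> A. p a = i \<and> q (g a) = j}" for i j
    using assms by auto
  then show ?thesis
    by (simp add: block_count_def fun_eq_iff)
qed

text \<open>
  Exchanging the values at two vertices of one row class only reorders the elements counted in
  that row.
\<close>

lemma block_count_transpose:
  assumes "a \<in> A" "b \<in> A" "p a = p b"
    and g: "\<And>c. c \<in> A \<Longrightarrow> g c = f (transpose a b c)"
  shows "block_count A p q g = block_count A p q f"
proof (intro ext)
  fix i j
  let ?t = "transpose a b"
  have A: "?t c \<in> A" if "c \<in> A" for c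
    using that assms by (auto simp: transpose_def)
  have p: "p (?t c) = p c" for c
    using assms by (auto simp: transpose_def)
  have "bij_betw ?t {c \<in> A. p c = i \<and> q (g c) = j} {c \<in> A. p c = i \<and> q (f c) = j}"
    by (rule bij_betw_byWitness[where f' = ?t]) (auto simp: A p g)
  then show "block_count A p q g i j = block_count A p q f i j"
    unfolding block_count_def by (rule bij_betw_same_card)
qed


section \<open>Realising prescribed block counts\<close>

lemma bij_betw_of_card_fibres_eq:
  assumes "finite A" "finite B"
    and card: "\<And>i. card {a \<in> A. p a = i} = card {b \<in> B. q b = i}"
  obtains f where "bij_betw f A B" and "\<forall>a \<in> A. q (f a) = p a"
proof -
  have "\<exists>h. bij_betw h {a \<in> A. p a = i} {b \<in> B. q b = i}" for i
    using assms by (intro finite_same_card_bij) auto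
  then obtain h where h: "bij_betw (h i) {a \<in> A. p a = i} {b \<in> B. q b = i}" for i
    by metis
  define f where "f a = h (p a) a" for a
  have f: "f a \<in> B" "q (f a) = p a" if "a \<in> A" for a
    using bij_betwE[OF h[of "p a"]] that by (auto simp: f_def)
  have "inj_on f A"
  proof (rule inj_onI)
    fix a b assume ab: "a \<in> A" "b \<in> A" "f a = f b"
    then have "p a = p b"
      using f by metis
    with ab show "a = b"
      using bij_betw_imp_inj_on[OF h[of "p b"]] by (auto simp: f_def dest: inj_onD)
  qed
  moreover have "B \<subseteq> f ` A"
  proof
    fix b assume "b \<in> B"
    then have "b \<in> h (q b) ` {a \<in> A. p a = q b}"
      using bij_betw_imp_surj_on[OF h[of "q b"]] by auto
    then obtain a where "a \<in> A" "p a = q b" "b = h (q b) a"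
      by blast
    then show "b \<in> f ` A"
      by (metis f_def imageI)
  qed
  ultimately have "bij_betw f A B"
    using f by (auto simp: bij_betw_def)
  with f(2) show ?thesis
    by (intro that[of f]) simp_all
qed

text \<open>
  The set \<open>T\<close> of triples \<open>(i, j, k)\<close> with \<open>k < M i j\<close> is a model of the situation: it has
  \<open>M i j\<close> elements with labels \<open>i\<close> and \<open>j\<close>. The row sums make \<open>A\<close> equinumerous with
  \<open>T\<close> label by label for the first label, the column sums do the same for \<open>B\<close> and the
  second label, and the bijection sought goes from \<open>A\<close> to \<open>B\<close> through \<open>T\<close>.
\<close>

lemma exists_bij_with_block_counts:
  fixes M :: "nat \<Rightarrow> nat \<Rightarrow> nat"
  assumes fin: "finite A" "finite B"
    and pr: "\<And>a. a \<in> A \<Longrightarrow> p a < r" and qs: "\<And>b. b \<in> B \<Longrightarrow> q b < s"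
    and row: "\<And>i. i < r \<Longrightarrow> (\<Sum>j<s. M i j) = card {a \<in> A. p a = i}"
    and col: "\<And>j. j < s \<Longrightarrow> (\<Sum>i<r. M i j) = card {b \<in> B. q b = j}"
  obtains f where "bij_betw f A B" and "\<forall>i < r. \<forall>j < s. block_count A p q f i j = M i j"
proof -
  define T where "T = (SIGMA i:{..<r}. SIGMA j:{..<s}. {..<M i j})"
  have finT: "finite T"
    by (auto simp: T_def)
  have "card {a \<in> A. p a = i} = card {t \<in> T. fst t = i}" for i
  proof (cases "i < r")
    case True
    then have "{t \<in> T. fst t = i} = Pair i ` (SIGMA j:{..<s}. {..<M i j})"
      by (auto simp: T_def)
    then show ?thesis
      using row[OF True] by (simp add: card_image inj_on_def)
  next
    case False
    then have "{a \<in> A. p a = i} = {}" "{t \<in> T. fst t = i} = {}"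
      using pr by (auto simp: T_def)
    then show ?thesis
      by (simp only: card.empty)
  qed
  then obtain \<phi> where \<phi>: "bij_betw \<phi> A T" "\<forall>a \<in> A. fst (\<phi> a) = p a"
    by (rule bij_betw_of_card_fibres_eq[OF fin(1) finT])
  have "card {b \<in> B. q b = j} = card {t \<in> T. fst (snd t) = j}" for j
  proof (cases "j < s")
    case True
    then have "{t \<in> T. fst (snd t) = j} = (\<lambda>(i, k). (i, j, k)) ` (SIGMA i:{..<r}. {..<M i j})"
      by (force simp: T_def)
    moreover have "inj_on (\<lambda>(i, k). (i, j, k)) (SIGMA i:{..<r}. {..<M i j})"
      by (auto simp: inj_on_def)
    ultimately show ?thesis
      using col[OF True] by (simp add: card_image)
  next
    case False
    then have "{b \<in> B. q b = j} = {}" "{t \<in> T. fst (snd t) = j} = {}"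
      using qs by (auto simp: T_def)
    then show ?thesis
      by (simp only: card.empty)
  qed
  then obtain \<psi> where \<psi>: "bij_betw \<psi> B T" "\<forall>b \<in> B. fst (snd (\<psi> b)) = q b"
    by (rule bij_betw_of_card_fibres_eq[OF fin(2) finT])
  define f where "f = inv_into B \<psi> \<circ> \<phi>"
  have bij: "bij_betw f A B"
    unfolding f_def using \<phi>(1) bij_betw_inv_into[OF \<psi>(1)] by (rule bij_betw_trans)
  have qf: "q (f a) = fst (snd (\<phi> a))" if "a \<in> A" for a
  proof -
    have "\<psi> (f a) = \<phi> a"
      using bij_betwE[OF \<phi>(1)] that
      by (simp add: f_def bij_betw_inv_into_right[OF \<psi>(1)])
    then show ?thesis
      using \<psi>(2) bij_betwE[OF bij] that by metis
  qed
  have "block_count A p q f i j = M i j" if "i < r" "j < s" for i j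
  proof -
    have "bij_betw \<phi> {a \<in> A. p a = i \<and> q (f a) = j} {t \<in> T. fst t = i \<and> fst (snd t) = j}"
      using \<phi> qf unfolding bij_betw_def by (auto simp: inj_on_def image_iff)
    moreover have "{t \<in> T. fst t = i \<and> fst (snd t) = j} = (\<lambda>k. (i, j, k)) ` {..<M i j}"
      using that by (auto simp: T_def)
    ultimately show ?thesis
      unfolding block_count_def
      by (simp add: bij_betw_same_card card_image inj_on_def)
  qed
  with bij show ?thesis
    by (intro that[of f]) simp_all
qed


section \<open>The invariant of friends-and-strangers graphs\<close>

text \<open>
  For a bijection \<open>\<sigma>\<close> this is, away from \<open>x\<^sub>0\<close>, the composition of \<open>\<sigma>\<close> with the
  transposition of \<open>y\<^sub>0\<close> and \<open>\<sigma> x\<^sub>0\<close>; there it never takes the value \<open>y\<^sub>0\<close>, so that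
  every value has a component of \<open>Y - y\<^sub>0\<close>.
\<close>

definition bypass :: "'a \<Rightarrow> 'b \<Rightarrow> ('a \<Rightarrow> 'b) \<Rightarrow> 'a \<Rightarrow> 'b" where
  "bypass x\<^sub>0 y\<^sub>0 \<sigma> a = (if \<sigma> a = y\<^sub>0 then \<sigma> x\<^sub>0 else \<sigma> a)"

text \<open>
  If neither swapped value is \<open>y\<^sub>0\<close>, then the vertex sent to \<open>y\<^sub>0\<close> lies outside the swapped
  edge. Its bypassed value is \<open>\<sigma> x\<^sub>0\<close>, that of \<open>b\<close> is \<open>\<sigma> b\<close>, and the swap
  exchanges the two; this is where equal labels of \<open>\<sigma> x\<^sub>0\<close> and \<open>\<sigma> b\<close> are needed.
  If one of the swapped values is \<open>y\<^sub>0\<close>, the other one is the bypassed value of \<open>b\<close> before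
  and after the swap.
\<close>

lemma label_bypass_swap_at_x0:
  assumes bij: "bij_betw \<sigma> V W" and xb: "x\<^sub>0 \<in> V" "b \<in> V" "b \<noteq> x\<^sub>0"
    and swap: "\<tau> x\<^sub>0 = \<sigma> b" "\<tau> b = \<sigma> x\<^sub>0" "\<And>c. c \<in> V - {x\<^sub>0, b} \<Longrightarrow> \<tau> c = \<sigma> c"
    and q: "\<lbrakk>\<sigma> x\<^sub>0 \<noteq> y\<^sub>0; \<sigma> b \<noteq> y\<^sub>0\<rbrakk> \<Longrightarrow> q (\<sigma> x\<^sub>0) = q (\<sigma> b)"
    and c: "c \<in> V - {x\<^sub>0}"
  shows "q (bypass x\<^sub>0 y\<^sub>0 \<tau> c) = q (bypass x\<^sub>0 y\<^sub>0 \<sigma> c)"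
proof -
  have inj: "\<sigma> u = \<sigma> v \<longleftrightarrow> u = v" if "u \<in> V" "v \<in> V" for u v
    using bij_betw_imp_inj_on[OF bij] that by (auto dest: inj_onD)
  show ?thesis
  proof (cases "c = b")
    case True
    then show ?thesis
      using inj[OF xb(1,2)] xb q by (auto simp: bypass_def swap)
  next
    case False
    then show ?thesis
      using inj[of c x\<^sub>0] inj[of c b] xb c q by (auto simp: bypass_def swap)
  qed
qed

lemma block_count_FS_arc:
  assumes "pair_graph X" "pair_graph Y" "x\<^sub>0 \<in> pverts X"
    and p: "\<And>a b. \<lbrakk>(a, b) \<in> parcs X; a \<noteq> x\<^sub>0; b \<noteq> x\<^sub>0\<rbrakk> \<Longrightarrow> p a = p b"
    and q: "\<And>a b. \<lbrakk>(a, b) \<in> parcs Y; a \<noteq> y\<^sub>0; b \<noteq> y\<^sub>0\<rbrakk> \<Longrightarrow> q a = q b"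
    and arc: "(\<sigma>, \<tau>) \<in> parcs (FS X Y)"
  shows "block_count (pverts X - {x\<^sub>0}) p q (bypass x\<^sub>0 y\<^sub>0 \<sigma>) =
    block_count (pverts X - {x\<^sub>0}) p q (bypass x\<^sub>0 y\<^sub>0 \<tau>)"
proof -
  interpret X: pair_graph X by fact
  interpret Y: pair_graph Y by fact
  from arc obtain a b where ab: "(a, b) \<in> parcs X" "(\<sigma> a, \<sigma> b) \<in> parcs Y"
      "\<tau> b = \<sigma> a" "\<tau> a = \<sigma> b" "\<And>c. c \<in> pverts X - {a, b} \<Longrightarrow> \<tau> c = \<sigma> c"
      and \<sigma>: "bij_betw \<sigma> (pverts X) (pverts Y)"
    unfolding FS_def bijections_def by fastforce
  have V: "a \<in> pverts X" "b \<in> pverts X" and neq: "a \<noteq> b"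
    using ab(1) X.wellformed[of "(a, b)"] X.no_loops'[of a b] by auto
  have ba: "(\<sigma> b, \<sigma> a) \<in> parcs Y"
    using Y.graph_symmetric[of "\<sigma> a" "\<sigma> b"] ab(2) by simp
  consider "a = x\<^sub>0" | "b = x\<^sub>0" | "a \<noteq> x\<^sub>0" "b \<noteq> x\<^sub>0"
    by blast
  then show ?thesis
  proof cases
    case 1
    have "q (bypass x\<^sub>0 y\<^sub>0 \<tau> c) = q (bypass x\<^sub>0 y\<^sub>0 \<sigma> c)" if "c \<in> pverts X - {x\<^sub>0}" for c
      using 1 V neq ab q[OF ab(2)] that
      by (intro label_bypass_swap_at_x0[OF \<sigma>, where b = b]) auto
    then show ?thesis
      by (intro block_count_cong) simp
  next
    case 2
    have "q (bypass x\<^sub>0 y\<^sub>0 \<tau> c) = q (bypass x\<^sub>0 y\<^sub>0 \<sigma> c)" if "c \<in> pverts X - {x\<^sub>0}" for c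
      using 2 V neq ab q[OF ba] that
      by (intro label_bypass_swap_at_x0[OF \<sigma>, where b = a]) auto
    then show ?thesis
      by (intro block_count_cong) simp
  next
    case 3
    then have "\<tau> x\<^sub>0 = \<sigma> x\<^sub>0"
      using ab(5) assms(3) by auto
    then have "bypass x\<^sub>0 y\<^sub>0 \<tau> c = bypass x\<^sub>0 y\<^sub>0 \<sigma> (transpose a b c)"
      if "c \<in> pverts X - {x\<^sub>0}" for c
      using that ab(3-5) by (auto simp: bypass_def transpose_def)
    then show ?thesis
      using 3 V p[OF ab(1)] by (intro block_count_transpose[symmetric]) auto
  qed
qed

theorem proposition2p6:
  fixes X :: "'a pair_pre_digraph" and Y :: "'b pair_pre_digraph"
    and n r s :: nat and x\<^sub>0 :: 'a and y\<^sub>0 :: 'b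
    and Xc :: "nat \<Rightarrow> ('a, 'a \<times> 'a) pre_digraph" and Yc :: "nat \<Rightarrow> ('b, 'b \<times> 'b) pre_digraph"
  assumes "pair_graph X" and "pair_graph Y"
    and "Digraph_Component.connected (with_proj X)" and "Digraph_Component.connected (with_proj Y)"
    and "n \<ge> 3" and "card (pverts X) = n" and "card (pverts Y) = n"
    and "cut_vertex X x\<^sub>0" and "cut_vertex Y y\<^sub>0"
    and "bij_betw Xc {..<r} (components (delete_vertex X x\<^sub>0))"
    and "bij_betw Yc {..<s} (components (delete_vertex Y y\<^sub>0))"
  shows "card (components (with_proj (FS X Y))) \<ge>
    card (matrices_with_sums r s (\<lambda>i. card (verts (Xc i))) (\<lambda>j. card (verts (Yc j))))"
proof -
  interpret X: pair_graph X by fact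
  interpret Y: pair_graph Y by fact
  interpret FS: pair_graph "FS X Y"
    using assms(1,2) by (rule pair_graph_FS)
  have x\<^sub>0: "x\<^sub>0 \<in> pverts X" and y\<^sub>0: "y\<^sub>0 \<in> pverts Y"
    using assms(8,9) by (auto simp: cut_vertex_def)
  let ?A = "pverts X - {x\<^sub>0}" and ?B = "pverts Y - {y\<^sub>0}"
  obtain p where p: "\<forall>v \<in> ?A. p v < r"
      "\<forall>i < r. {v \<in> ?A. p v = i} = verts (Xc i)"
      "\<forall>a b. (a, b) \<in> parcs X \<longrightarrow> a \<noteq> x\<^sub>0 \<longrightarrow> b \<noteq> x\<^sub>0 \<longrightarrow> p a = p b"
    by (rule vertex_labelling_of_delete_vertex[OF assms(1,10)])
  obtain q where q: "\<forall>v \<in> ?B. q v < s"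
      "\<forall>j < s. {v \<in> ?B. q v = j} = verts (Yc j)"
      "\<forall>a b. (a, b) \<in> parcs Y \<longrightarrow> a \<noteq> y\<^sub>0 \<longrightarrow> b \<noteq> y\<^sub>0 \<longrightarrow> q a = q b"
    by (rule vertex_labelling_of_delete_vertex[OF assms(2,11)])
  define F where "F \<sigma> = mat r s (\<lambda>(i, j). block_count ?A p q (bypass x\<^sub>0 y\<^sub>0 \<sigma>) i j)" for \<sigma>
  have "F \<sigma> = F \<tau>" if "\<sigma> \<rightarrow>\<^bsub>with_proj (FS X Y)\<^esub> \<tau>" for \<sigma> \<tau>
  proof -
    have "(\<sigma>, \<tau>) \<in> parcs (FS X Y)"
      using that by (auto simp: arcs_ends_conv)
    from block_count_FS_arc[OF assms(1,2) x\<^sub>0 p(3)[rule_format] q(3)[rule_format] this] show ?thesis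
      by (simp add: F_def)
  qed
  moreover have "M \<in> F ` verts (with_proj (FS X Y))"
    if M: "M \<in> matrices_with_sums r s (\<lambda>i. card (verts (Xc i))) (\<lambda>j. card (verts (Yc j)))" for M
  proof -
    have row: "(\<Sum>j<s. M $$ (i, j)) = card {a \<in> ?A. p a = i}" if "i < r" for i
      using M that p(2) by (simp add: matrices_with_sums_def)
    have col: "(\<Sum>i<r. M $$ (i, j)) = card {b \<in> ?B. q b = j}" if "j < s" for j
      using M that q(2) by (simp add: matrices_with_sums_def)
    have "finite ?A" "finite ?B"
      by simp_all
    from exists_bij_with_block_counts[OF this _ _ row col] p(1) q(1)
    obtain f where f: "bij_betw f ?A ?B"
        "\<forall>i < r. \<forall>j < s. block_count ?A p q f i j = M $$ (i, j)"
      by blast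
    \<comment> \<open>As \<open>\<sigma> x\<^sub>0 = y\<^sub>0\<close>, bypassing changes no other value, so \<open>\<sigma>\<close> keeps the counts of \<open>f\<close>.\<close>
    define \<sigma> where "\<sigma> = restrict (f(x\<^sub>0 := y\<^sub>0)) (pverts X)"
    have \<sigma>f: "\<sigma> c = f c" "\<sigma> c \<noteq> y\<^sub>0" if "c \<in> ?A" for c
      using that bij_betwE[OF f(1)] by (auto simp: \<sigma>_def)
    have "\<sigma> x\<^sub>0 = y\<^sub>0"
      using x\<^sub>0 by (simp add: \<sigma>_def)
    moreover have "bij_betw \<sigma> ?A ?B"
      using f(1) bij_betw_cong[of ?A \<sigma> f ?B] \<sigma>f(1) by blast
    ultimately have "bij_betw \<sigma> (insert x\<^sub>0 ?A) (insert y\<^sub>0 ?B)"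
      using notIn_Un_bij_betw[of x\<^sub>0 ?A \<sigma> ?B] by simp
    then have "\<sigma> \<in> verts (with_proj (FS X Y))"
      using x\<^sub>0 y\<^sub>0 by (simp add: FS_def bijections_def insert_absorb \<sigma>_def)
    moreover have "block_count ?A p q (bypass x\<^sub>0 y\<^sub>0 \<sigma>) = block_count ?A p q f"
      using \<sigma>f by (intro block_count_cong) (simp add: bypass_def)
    then have "F \<sigma> = M"
      using M f(2) by (intro eq_matI) (auto simp: F_def matrices_with_sums_def)
    ultimately show ?thesis
      by blast
  qed
  ultimately show ?thesis
    by (intro FS.card_le_card_sccs_of_invariant[where f = F]) auto
qed

end
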